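(* Let $n\ge 1$ be an integer and let $V(\mathbf{t}) = V(t_1,\ldots,t_n)$ be the Vandermonde polynomial. Then for each $k=1,\ldots,n$ and all $t_1,\ldots,t_n\in\mathbb{R}$, $$\sum_{i=1}^n \frac{\partial^k}{\partial t_i^k} V(\mathbf{t}) = 0 .$$
   Context: The Vandermonde polynomial is $V(t_1,\ldots,t_n) := \prod_{1\le i<j\le n}(t_j-t_i)$ (the empty product is $1$, so $V=1$ when $n=1$). *)

theory Defs
  imports "HOL-Analysis.Analysis"
begin

(* A point (t_1, ..., t_n) of R^n is a function t :: nat => real of which only
   the values t 1, ..., t n are used. *)

definition vandermonde :: "nat \<Rightarrow> (nat \<Rightarrow> real) \<Rightarrow> real" where
  "vandermonde n t = (\<Prod>(i, j) \<in> {(i, j). 1 \<le> i \<and> i < j \<and> j \<le> n}. t j - t i)"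

(* "deriv" is the actual derivative wherever one exists and unspecified
   otherwise; here it is applied only to functions polynomial in each variable. *)

definition partial_deriv ::
  "nat \<Rightarrow> ((nat \<Rightarrow> real) \<Rightarrow> real) \<Rightarrow> (nat \<Rightarrow> real) \<Rightarrow> real" where
  "partial_deriv i f = (\<lambda>t. deriv (\<lambda>x. f (t(i := x))) (t i))"

end

theory Submission
  imports Defs "HOL-Computational_Algebra.Polynomial"
begin

text \<open>
  Fix \<open>\<t> = (t\<^sub>1, \<dots>, t\<^sub>n)\<close>.  As a function of its \<open>i\<close>-th variable alone the Vandermonde polynomial is
  \<open>C\<^sub>i P\<^sub>i(x)\<close>, where \<open>P\<^sub>i(x)\<close> is the product of \<open>x - t\<^sub>j\<close> over \<open>j \<noteq> i\<close> and the cofactor \<open>C\<^sub>i\<close> is, up to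
  sign, the Vandermonde polynomial of the other variables.  With \<open>P(x) = (x - t\<^sub>i) P\<^sub>i(x)\<close>, which
  is the same polynomial for every \<open>i\<close>, the Leibniz rule gives
  \<open>P\<^sup>(\<^sup>k\<^sup>+\<^sup>1\<^sup>)(t\<^sub>i) = (k + 1) P\<^sub>i\<^sup>(\<^sup>k\<^sup>)(t\<^sub>i)\<close>.  Hence the sum in question is
  \<open>\<Sum>\<^sub>i C\<^sub>i Q(t\<^sub>i)\<close> with the single polynomial \<open>Q = P\<^sup>(\<^sup>k\<^sup>+\<^sup>1\<^sup>) / (k + 1)\<close>, whose degree is below \<open>n - 1\<close>
  because \<open>k \<ge> 1\<close>.

  It remains to see that \<open>\<Sum>\<^sub>i C\<^sub>i Q(t\<^sub>i) = 0\<close> for every \<open>Q\<close> of degree below \<open>n - 1\<close>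
  (\<open>sum_vandermonde_cofactor_poly\<close>).  For distinct nodes, \<open>C\<^sub>i = V(\<t>) / P\<^sub>i(t\<^sub>i)\<close>, so up to the factor
  \<open>V(\<t>)\<close> the sum is the coefficient of \<open>x\<^sup>n\<^sup>-\<^sup>1\<close> in the Lagrange interpolant of \<open>Q\<close>, that is, in \<open>Q\<close>
  itself (\<open>lagrange_top_coeff_zero\<close>).  Coinciding nodes are reached as limits of distinct ones.
\<close>

section \<open>The top coefficient in Lagrange interpolation\<close>

text \<open>
  The polynomial \<open>\<Sum>\<^sub>i w\<^sub>i Q(t\<^sub>i) P\<^sub>i - v Q\<close>, with \<open>P\<^sub>i\<close> the product of \<open>x - t\<^sub>j\<close> over \<open>j \<noteq> i\<close>, has degree
  less than the number of nodes and vanishes at all of them, so it is zero.  Its top coefficient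
  is the sum below, since \<open>P\<^sub>i\<close> is monic and \<open>Q\<close> does not reach that degree.  Stating the
  hypothesis as \<open>w\<^sub>i P\<^sub>i(t\<^sub>i) = v\<close> avoids divisions.
\<close>

lemma lagrange_top_coeff_zero:
  fixes t w :: "'i \<Rightarrow> 'a :: idom"
  assumes fin: "finite I" and inj: "inj_on t I"
    and Q: "\<And>m. card I \<le> Suc m \<Longrightarrow> coeff Q m = 0"
    and w: "\<And>i. i \<in> I \<Longrightarrow> w i * (\<Prod>j\<in>I - {i}. t i - t j) = v"
  shows "(\<Sum>i\<in>I. w i * poly Q (t i)) = 0"
proof (cases "I = {}")
  case False
  define N where "N = card I - 1"
  have card: "card I = Suc N"
    using fin False by (simp add: N_def card_gt_0_iff)
  define P where "P i = (\<Prod>j\<in>I - {i}. [:- t j, 1:])" for i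
  have degP: "degree (P i) = N" if "i \<in> I" for i
    using that fin by (simp add: P_def degree_prod_sum_eq N_def)
  have monic: "coeff (P i) N = 1" if "i \<in> I" for i
    using lead_coeff_prod[of "\<lambda>j. [:- t j, 1:]" "I - {i}"] degP[OF that] by (simp add: P_def)
  define R where "R = (\<Sum>i\<in>I. smult (w i * poly Q (t i)) (P i)) - smult v Q"
  have degR: "degree R < card I"
  proof -
    have "degree R \<le> N"
    proof (rule degree_le, intro allI impI)
      fix m assume "N < m"
      then show "coeff R m = 0"
        using degP Q[of m] card by (simp add: R_def coeff_sum coeff_eq_0)
    qed
    then show ?thesis using card by simp
  qed
  have root: "poly R (t j) = 0" if "j \<in> I" for j
  proof -
    have "poly (P i) (t j) = 0" if "i \<in> I - {j}" for i
      using that \<open>j \<in> I\<close> fin by (auto simp: P_def poly_prod prod_zero_iff)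
    then have "(\<Sum>i\<in>I. w i * poly Q (t i) * poly (P i) (t j)) = w j * poly Q (t j) * poly (P j) (t j)"
      using fin \<open>j \<in> I\<close> by (simp add: sum.remove)
    also have "\<dots> = v * poly Q (t j)"
      using w[OF \<open>j \<in> I\<close>] by (simp add: P_def poly_prod algebra_simps)
    finally show ?thesis by (simp add: R_def poly_sum)
  qed
  have "R = 0"
    by (rule poly_eqI_degree[where A = "t ` I"])
       (use root degR inj False fin in \<open>auto simp: card_image card_gt_0_iff\<close>)
  then have "0 = coeff R N" by simp
  also have "\<dots> = (\<Sum>i\<in>I. w i * poly Q (t i))"
    using Q[of N] card monic by (simp add: R_def coeff_sum)
  finally show ?thesis by simp
qed simp

section \<open>The Vandermonde polynomial as a function of one variable\<close>

text \<open>
  The sign counts the factors \<open>t\<^sub>j - t\<^sub>i\<close> with \<open>j > i\<close>, which enter the product of the \<open>t\<^sub>i - t\<^sub>j\<close> reversed.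
\<close>

definition vandermonde_cofactor :: "nat \<Rightarrow> (nat \<Rightarrow> real) \<Rightarrow> nat \<Rightarrow> real" where
  "vandermonde_cofactor n t i =
    (-1) ^ (n - i) * (\<Prod>(a, b) \<in> {(a, b). 1 \<le> a \<and> a < b \<and> b \<le> n \<and> a \<noteq> i \<and> b \<noteq> i}. t b - t a)"

lemma vandermonde_one_variable:
  assumes i: "i \<in> {1..n}"
  shows "vandermonde n (t(i := x)) = vandermonde_cofactor n t i * (\<Prod>j\<in>{1..n} - {i}. x - t j)"
proof -
  let ?f = "\<lambda>(a, b). (t(i := x)) b - (t(i := x)) a"
  define A where "A = {(a, b). 1 \<le> a \<and> a < b \<and> b \<le> n \<and> a \<noteq> i \<and> b \<noteq> i}"
  define B where "B = (\<lambda>b. (i, b)) ` {i<..n}"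
  define C where "C = (\<lambda>a. (a, i)) ` {1..<i}"
  have fin: "finite A" "finite B" "finite C"
    by (rule finite_subset[of _ "{1..n} \<times> {1..n}"], auto simp: A_def B_def C_def)
  have pairs: "{(a, b). 1 \<le> a \<and> a < b \<and> b \<le> n} = A \<union> (B \<union> C)"
    using i by (auto simp: A_def B_def C_def)
  have disj: "A \<inter> (B \<union> C) = {}" "B \<inter> C = {}"
    by (auto simp: A_def B_def C_def)
  have prodA: "prod ?f A = (\<Prod>(a, b)\<in>A. t b - t a)"
    by (rule prod.cong) (auto simp: A_def)
  have "prod ?f B = (\<Prod>b\<in>{i<..n}. t b - x)"
    unfolding B_def by (subst prod.reindex) (auto simp: inj_on_def intro!: prod.cong)
  also have "\<dots> = (\<Prod>b\<in>{i<..n}. (-1) * (x - t b))"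
    by simp
  also have "\<dots> = (-1) ^ (n - i) * (\<Prod>b\<in>{i<..n}. x - t b)"
    by (subst prod.distrib) simp
  finally have prodB: "prod ?f B = (-1) ^ (n - i) * (\<Prod>b\<in>{i<..n}. x - t b)" .
  have prodC: "prod ?f C = (\<Prod>a\<in>{1..<i}. x - t a)"
    unfolding C_def by (subst prod.reindex) (auto simp: inj_on_def intro!: prod.cong)
  have rest: "{1..n} - {i} = {i<..n} \<union> {1..<i}"
    using i by auto
  have "(\<Prod>j\<in>{1..n} - {i}. x - t j) = (\<Prod>b\<in>{i<..n}. x - t b) * (\<Prod>a\<in>{1..<i}. x - t a)"
    unfolding rest by (rule prod.union_disjoint) auto
  then show ?thesis
    unfolding vandermonde_def vandermonde_cofactor_def pairs A_def[symmetric]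
    using fin disj by (simp add: prod.union_disjoint prodA prodB prodC del: fun_upd_apply)
qed

text \<open>
  For distinct nodes this is Lagrange interpolation with \<open>v = V(\<t>)\<close>.  In general the nodes
  \<open>t\<^sub>i + e i\<close> are distinct for all but finitely many real \<open>e\<close>, and the sum depends continuously
  on \<open>e\<close>, so its value at \<open>e = 0\<close> vanishes too.
\<close>

lemma sum_vandermonde_cofactor_poly:
  assumes Q: "\<And>m. n \<le> Suc m \<Longrightarrow> coeff Q m = 0"
  shows "(\<Sum>i = 1..n. vandermonde_cofactor n t i * poly Q (t i)) = 0"
proof -
  define S where "S s = (\<Sum>i = 1..n. vandermonde_cofactor n s i * poly Q (s i))" for s
  have distinct: "S s = 0" if "inj_on s {1..n}" for s
    unfolding S_def
  proof (rule lagrange_top_coeff_zero)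
    show "vandermonde_cofactor n s i * (\<Prod>j\<in>{1..n} - {i}. s i - s j) = vandermonde n s"
      if "i \<in> {1..n}" for i
      using vandermonde_one_variable[OF that, of s "s i"] by simp
  qed (use that Q in auto)
  define moved where "moved e j = t j + e * real j" for e j
  define bad where "bad = {e. \<not> inj_on (moved e) {1..n}}"
  have "bad \<subseteq> (\<lambda>(a, b). (t b - t a) / (real a - real b)) ` ({1..n} \<times> {1..n})"
  proof
    fix e assume "e \<in> bad"
    then obtain a b where ab: "a \<in> {1..n}" "b \<in> {1..n}" "a \<noteq> b" "moved e a = moved e b"
      by (auto simp: bad_def inj_on_def)
    then have "e = (t b - t a) / (real a - real b)"
      by (simp add: moved_def field_simps)
    then show "e \<in> (\<lambda>(a, b). (t b - t a) / (real a - real b)) ` ({1..n} \<times> {1..n})"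
      using ab by auto
  qed
  then have "finite bad"
    by (rule finite_subset) auto
  then have dense: "closure (- bad) = UNIV"
    by (simp add: closure_complement empty_interior_finite)
  have cont: "continuous_on (closure (- bad)) (\<lambda>e. S (moved e))"
    unfolding S_def vandermonde_cofactor_def moved_def case_prod_unfold
    by (intro continuous_intros)
  have "S (moved 0) = 0"
    by (rule continuous_constant_on_closure[OF cont])
       (use dense distinct in \<open>auto simp: bad_def\<close>)
  then show ?thesis
    by (simp add: S_def) (simp add: moved_def[abs_def])
qed

section \<open>Iterated derivatives\<close>

lemma partial_deriv_funpow:
  "(partial_deriv i ^^ k) f t = (deriv ^^ k) (\<lambda>x. f (t(i := x))) (t i)"
proof (induction k arbitrary: t)
  case (Suc k)
  have "(partial_deriv i ^^ Suc k) f t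
      = deriv (\<lambda>y. (partial_deriv i ^^ k) f (t(i := y))) (t i)"
    by (simp add: partial_deriv_def)
  also have "\<dots> = deriv ((deriv ^^ k) (\<lambda>x. f (t(i := x)))) (t i)"
    by (simp only: Suc.IH fun_upd_upd fun_upd_same)
  finally show ?case by (simp del: fun_upd_apply)
qed simp

lemma deriv_funpow_poly:
  fixes p :: "'a :: real_normed_field poly"
  shows "(deriv ^^ k) (poly p) = poly ((pderiv ^^ k) p)"
proof (induction k)
  case (Suc k)
  have "deriv (poly q) = poly (pderiv q)" for q :: "'a poly"
    by (rule ext) (rule DERIV_imp_deriv[OF poly_DERIV])
  then show ?case using Suc by simp
qed simp

lemma pderiv_linear_mult:
  fixes p :: "'a :: {comm_ring_1, semiring_no_zero_divisors} poly"
  shows "pderiv ([:- c, 1:] * p) = p + [:- c, 1:] * pderiv p"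
  by (simp add: pderiv_mult pderiv_pCons del: mult_pCons_left)

text \<open>
  Only two terms of the Leibniz rule survive: the second derivative of the linear factor vanishes.
\<close>

lemma higher_pderiv_linear_mult:
  fixes p :: "'a :: {comm_ring_1, semiring_no_zero_divisors} poly"
  shows "(pderiv ^^ Suc k) ([:- c, 1:] * p)
    = [:- c, 1:] * (pderiv ^^ Suc k) p + of_nat (Suc k) * (pderiv ^^ k) p"
proof (induction k)
  case 0
  show ?case by (simp add: pderiv_linear_mult del: mult_pCons_left)
next
  case (Suc k)
  have "(pderiv ^^ Suc (Suc k)) ([:- c, 1:] * p)
      = pderiv ([:- c, 1:] * (pderiv ^^ Suc k) p + of_nat (Suc k) * (pderiv ^^ k) p)"
    using Suc by simp
  also have "\<dots> = [:- c, 1:] * (pderiv ^^ Suc (Suc k)) p + of_nat (Suc (Suc k)) * (pderiv ^^ Suc k) p"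
    by (simp add: pderiv_add pderiv_linear_mult pderiv_mult[of "of_nat _"] distrib_right add_ac
        del: mult_pCons_left)
  finally show ?case .
qed

text \<open>
  Differentiating once more replaces \<open>P\<^sub>i\<close>, which depends on \<open>i\<close>, by the common polynomial \<open>P\<close>.
\<close>

lemma partial_deriv_vandermonde:
  assumes i: "i \<in> {1..n}"
  shows "real (Suc k) * (partial_deriv i ^^ k) (vandermonde n) t
    = vandermonde_cofactor n t i * poly ((pderiv ^^ Suc k) (\<Prod>j = 1..n. [:- t j, 1:])) (t i)"
proof -
  define p where "p = (\<Prod>j\<in>{1..n} - {i}. [:- t j, 1:])"
  have "(\<lambda>x. vandermonde n (t(i := x))) = poly (smult (vandermonde_cofactor n t i) p)"
    using vandermonde_one_variable[OF i] by (auto simp: p_def poly_prod)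
  then have "(partial_deriv i ^^ k) (vandermonde n) t
      = vandermonde_cofactor n t i * poly ((pderiv ^^ k) p) (t i)"
    by (simp add: partial_deriv_funpow deriv_funpow_poly higher_pderiv_smult)
  moreover have "(\<Prod>j = 1..n. [:- t j, 1:]) = [:- t i, 1:] * p"
    unfolding p_def by (rule prod.remove) (use i in auto)
  then have "poly ((pderiv ^^ Suc k) (\<Prod>j = 1..n. [:- t j, 1:])) (t i)
      = real (Suc k) * poly ((pderiv ^^ k) p) (t i)"
    by (simp only: higher_pderiv_linear_mult) simp
  ultimately show ?thesis by simp
qed

section \<open>The power sums of partial derivatives annihilate the Vandermonde polynomial\<close>

theorem lemma4:
  fixes n k :: nat and t :: "nat \<Rightarrow> real"
  assumes "n \<ge> 1" and "k \<in> {1..n}"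
  shows "(\<Sum>i = 1..n. (partial_deriv i ^^ k) (vandermonde n) t) = 0"
proof -
  define P where "P = (\<Prod>j = 1..n. [:- t j, 1:])"
  have degP: "degree P = n"
    by (simp add: P_def degree_prod_sum_eq)
  have "real (Suc k) * (\<Sum>i = 1..n. (partial_deriv i ^^ k) (vandermonde n) t)
      = (\<Sum>i = 1..n. vandermonde_cofactor n t i * poly ((pderiv ^^ Suc k) P) (t i))"
    unfolding sum_distrib_left P_def by (intro sum.cong refl partial_deriv_vandermonde)
  also have "\<dots> = 0"
  proof (rule sum_vandermonde_cofactor_poly)
    fix m assume "n \<le> Suc m"
    then have "coeff P (m + Suc k) = 0"
      using assms(2) degP by (intro coeff_eq_0) auto
    then show "coeff ((pderiv ^^ Suc k) P) m = 0"
      by (simp only: coeff_higher_pderiv mult_zero_right)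
  qed
  finally show ?thesis by simp
qed

end
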